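(* Let $A$ and $B$ be stable matching instances on the same $n$ workers and $n$ firms in which every worker has the same preference list in $A$ as in $B$, and let $X$ be their compound instance. If $\mathcal{M}_A\cap\mathcal{M}_B\neq\emptyset$, then Algorithm WorkerOptimal-X run on $X$ outputs the worker-optimal matching of $\mathcal{M}_A\cap\mathcal{M}_B$, and Algorithm FirmOptimal-X run on $X$ outputs the firm-optimal matching of $\mathcal{M}_A\cap\mathcal{M}_B$.
   Context: In a stable matching instance each agent strictly totally orders the agents of the other side; a perfect matching $M$ is stable under $I$ if no pair $(w,f)\notin M$ has $w$ preferring $f$ to $M(w)$ and $f$ preferring $w$ to $M(f)$ under $I$; $\mathcal{M}_I$ is the set of stable matchings of $I$. The compound instance $X$: workers keep their common list; firm $f$ has partial order $w_i>^X_f w_j$ iff $w_i>^A_f w_j$ and $w_i>^B_f w_j$. The worker-optimal (resp. firm-optimal) matching of $\mathcal{M}_A\cap\mathcal{M}_B$ is the element that every worker (resp. every firm) weakly prefers to all other elements of $\mathcal{M}_A\cap\mathcal{M}_B$; such elements exist when the set is nonempty. Algorithm WorkerOptimal-X: each worker keeps a list of all firms in decreasing preference. Repeat until every worker holds an acceptance or some worker has been rejected by all firms: (a) each worker proposes to its best firm not crossed off its list; (b) each firm tentatively accepts the proposal from a worker that it strictly prefers under $X$ to every other worker who has ever proposed to it (in this or earlier rounds), if such a worker exists, and rejects all other proposals; (c) each rejected worker crosses the rejecting firm off its list. If every worker holds an acceptance, output the resulting perfect matching, otherwise output $\boxtimes$. Algorithm FirmOptimal-X: each firm keeps its partial order (a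 DAG) on workers. Repeat until every firm holds an acceptance or some firm has been rejected by all workers: (a) each firm proposes to every uncrossed worker $w$ such that no other uncrossed worker $w'$ satisfies $w'>^X_f w$; (b) each worker tentatively accepts its best proposal and rejects the rest; (c) each rejected firm crosses the rejecting worker off its DAG. If every firm holds an acceptance, output the resulting perfect matching, otherwise output $\boxtimes$.
   Formalization: In FirmOptimal-X, "every firm holds an acceptance" is taken to mean that each firm has an accepted proposal and none of its proposals in that round was rejected; with the literal stopping test the algorithm can stop too early and output a matching that is not stable under A. *)

theory Defs
  imports Main "HOL-Library.While_Combinator" "HOL-Library.Cardinality"
begin

(* (f, g) \<in> wpref I w means that worker w strictly prefers firm f to firm g;
   likewise (v, w) \<in> fpref I f means that firm f strictly prefers v to w.
   The record itself imposes no order axioms, so it also carries the compound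
   instance, whose firm preferences are only partial orders. *)
record ('w, 'f) prefs =
  wpref :: "'w \<Rightarrow> 'f rel"
  fpref :: "'f \<Rightarrow> 'w rel"

definition sm_instance :: "('w, 'f) prefs \<Rightarrow> bool" where
  "sm_instance I \<longleftrightarrow>
     (\<forall>w. strict_linear_order_on UNIV (wpref I w)) \<and>
     (\<forall>f. strict_linear_order_on UNIV (fpref I f))"

definition compound :: "('w, 'f) prefs \<Rightarrow> ('w, 'f) prefs \<Rightarrow> ('w, 'f) prefs" where
  "compound A B = \<lparr> wpref = wpref A, fpref = (\<lambda>f. fpref A f \<inter> fpref B f) \<rparr>"

definition perfect_matching :: "('w \<times> 'f) set \<Rightarrow> bool" where
  "perfect_matching M \<longleftrightarrow> (\<forall>w. \<exists>!f. (w, f) \<in> M) \<and> (\<forall>f. \<exists>!w. (w, f) \<in> M)"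

definition firm_of :: "('w \<times> 'f) set \<Rightarrow> 'w \<Rightarrow> 'f" where
  "firm_of M w = (THE f. (w, f) \<in> M)"

definition worker_of :: "('w \<times> 'f) set \<Rightarrow> 'f \<Rightarrow> 'w" where
  "worker_of M f = (THE w. (w, f) \<in> M)"

definition stable :: "('w, 'f) prefs \<Rightarrow> ('w \<times> 'f) set \<Rightarrow> bool" where
  "stable I M \<longleftrightarrow>
     \<not> (\<exists>w f. (w, f) \<notin> M \<and> (f, firm_of M w) \<in> wpref I w \<and> (w, worker_of M f) \<in> fpref I f)"

definition stable_matchings :: "('w, 'f) prefs \<Rightarrow> ('w \<times> 'f) set set" where
  "stable_matchings I = {M. perfect_matching M \<and> stable I M}"

definition worker_optimal :: "('w, 'f) prefs \<Rightarrow> ('w \<times> 'f) set set \<Rightarrow> ('w \<times> 'f) set \<Rightarrow> bool" where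
  "worker_optimal I S M \<longleftrightarrow> M \<in> S \<and>
     (\<forall>N\<in>S. \<forall>w. firm_of M w = firm_of N w \<or> (firm_of M w, firm_of N w) \<in> wpref I w)"

(* When I is a compound instance, weak preference of a firm under I is weak
   preference under both of the instances it is made of. *)
definition firm_optimal :: "('w, 'f) prefs \<Rightarrow> ('w \<times> 'f) set set \<Rightarrow> ('w \<times> 'f) set \<Rightarrow> bool" where
  "firm_optimal I S M \<longleftrightarrow> M \<in> S \<and>
     (\<forall>N\<in>S. \<forall>f. worker_of M f = worker_of N f \<or> (worker_of M f, worker_of N f) \<in> fpref I f)"

(* Boxtimes is the failure symbol.  The algorithms below return
   None     if the loop does not terminate,
   Some out if it terminates with output out. *)
datatype ('w, 'f) outcome = Boxtimes | Output "('w \<times> 'f) set"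


(* Worker-proposing algorithm.  All pairs are (worker, firm).
   wcrossed:  firms crossed off the workers' lists;
   wproposed: all proposals made so far, in this or an earlier round;
   waccepted: acceptances held at the end of the last round. *)
record ('w, 'f) wstate =
  wcrossed :: "('w \<times> 'f) set"
  wproposed :: "('w \<times> 'f) set"
  waccepted :: "('w \<times> 'f) set"

definition wproposals :: "('w, 'f) prefs \<Rightarrow> ('w \<times> 'f) set \<Rightarrow> ('w \<times> 'f) set" where
  "wproposals X C =
     {(w, f). (w, f) \<notin> C \<and> (\<forall>g. (w, g) \<notin> C \<and> g \<noteq> f \<longrightarrow> (f, g) \<in> wpref X w)}"

definition facceptances ::
    "('w, 'f) prefs \<Rightarrow> ('w \<times> 'f) set \<Rightarrow> ('w \<times> 'f) set \<Rightarrow> ('w \<times> 'f) set" where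
  "facceptances X H P =
     {(w, f). (w, f) \<in> P \<and> (\<forall>v. (v, f) \<in> H \<and> v \<noteq> w \<longrightarrow> (w, v) \<in> fpref X f)}"

definition wround :: "('w, 'f) prefs \<Rightarrow> ('w, 'f) wstate \<Rightarrow> ('w, 'f) wstate" where
  "wround X s =
     (let P = wproposals X (wcrossed s);
          H = wproposed s \<union> P;
          T = facceptances X H P
      in \<lparr> wcrossed = wcrossed s \<union> (P - T), wproposed = H, waccepted = T \<rparr>)"

definition all_workers_hold :: "('w, 'f) wstate \<Rightarrow> bool" where
  "all_workers_hold s \<longleftrightarrow> (\<forall>w. \<exists>f. (w, f) \<in> waccepted s)"

definition worker_exhausted :: "('w, 'f) wstate \<Rightarrow> bool" where
  "worker_exhausted s \<longleftrightarrow> (\<exists>w. \<forall>f. (w, f) \<in> wcrossed s)"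

(* Types are nonempty, so the stopping test is false in the initial state and
   the while loop is the same as repeat-until. *)
definition WorkerOptimal_X :: "('w, 'f) prefs \<Rightarrow> ('w, 'f) outcome option" where
  "WorkerOptimal_X X = map_option
     (\<lambda>s. if all_workers_hold s then Output (waccepted s) else Boxtimes)
     (while_option (\<lambda>s. \<not> (all_workers_hold s \<or> worker_exhausted s)) (wround X)
        \<lparr> wcrossed = {}, wproposed = {}, waccepted = {} \<rparr>)"


(* Firm-proposing algorithm.  All pairs are again (worker, firm).
   fcrossed:  workers crossed off the firms' DAGs;
   faccepted: proposals accepted in the last round;
   frejected: proposals rejected in the last round.
   An accepted worker stays uncrossed and maximal, hence is proposed to again in
   the next round: the proposals of a round include the acceptances still held. *)
record ('w, 'f) fstate =
  fcrossed :: "('w \<times> 'f) set"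
  faccepted :: "('w \<times> 'f) set"
  frejected :: "('w \<times> 'f) set"

definition fproposals :: "('w, 'f) prefs \<Rightarrow> ('w \<times> 'f) set \<Rightarrow> ('w \<times> 'f) set" where
  "fproposals X C =
     {(w, f). (w, f) \<notin> C \<and> \<not> (\<exists>v. v \<noteq> w \<and> (v, f) \<notin> C \<and> (v, w) \<in> fpref X f)}"

definition wacceptances :: "('w, 'f) prefs \<Rightarrow> ('w \<times> 'f) set \<Rightarrow> ('w \<times> 'f) set" where
  "wacceptances X P =
     {(w, f). (w, f) \<in> P \<and> (\<forall>g. (w, g) \<in> P \<and> g \<noteq> f \<longrightarrow> (f, g) \<in> wpref X w)}"

definition fround :: "('w, 'f) prefs \<Rightarrow> ('w, 'f) fstate \<Rightarrow> ('w, 'f) fstate" where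
  "fround X s =
     (let P = fproposals X (fcrossed s);
          T = wacceptances X P
      in \<lparr> fcrossed = fcrossed s \<union> (P - T), faccepted = T, frejected = P - T \<rparr>)"

(* A firm can have several proposals out in one round, some accepted and some
   rejected.  A firm that was rejected in the round still has to cross off workers
   and propose anew, so it does not count as holding an acceptance.  Without the
   second conjunct the loop could stop too early.  Example: f ranks b > c > a in A
   and a > b > c in B, g ranks b first and h ranks c first in both; a ranks h > f > g,
   b ranks g first, c ranks f > h > g.  In round one a accepts f, b accepts g
   (rejecting f) and c accepts h, but (c, f) blocks {(a,f), (b,g), (c,h)} in A, while
   {(a,h), (b,g), (c,f)} is stable in A and in B. *)
definition holds_acceptance :: "('w, 'f) fstate \<Rightarrow> 'f \<Rightarrow> bool" where
  "holds_acceptance s f \<longleftrightarrow> (\<exists>w. (w, f) \<in> faccepted s) \<and> \<not> (\<exists>w. (w, f) \<in> frejected s)"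

definition all_firms_hold :: "('w, 'f) fstate \<Rightarrow> bool" where
  "all_firms_hold s \<longleftrightarrow> (\<forall>f. holds_acceptance s f)"

definition firm_exhausted :: "('w, 'f) fstate \<Rightarrow> bool" where
  "firm_exhausted s \<longleftrightarrow> (\<exists>f. \<forall>w. (w, f) \<in> fcrossed s)"

definition FirmOptimal_X :: "('w, 'f) prefs \<Rightarrow> ('w, 'f) outcome option" where
  "FirmOptimal_X X = map_option
     (\<lambda>s. if all_firms_hold s then Output (faccepted s) else Boxtimes)
     (while_option (\<lambda>s. \<not> (all_firms_hold s \<or> firm_exhausted s)) (fround X)
        \<lparr> fcrossed = {}, faccepted = {}, frejected = {} \<rparr>)"

end

(* Write S for the set of matchings stable in both A and B.  A perfect matching M is in S
   iff, whenever a worker w prefers a firm f to its partner in M, the partner of f in M is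
   above w in the compound order of f.  Hence both algorithms can be analysed in X alone.
   By induction on the rounds neither algorithm ever crosses off a pair of a member of S, so
   neither gets stuck.  For workers proposing, the final acceptance of f beats everyone who
   ever proposed to f, so nothing blocks.  For firms proposing, the single proposal each firm
   ends with is the only maximal uncrossed worker and therefore, by finiteness, above all
   other uncrossed workers.  As all partners in members of S are uncrossed, the output is
   optimal in both cases. *)

theory Submission
  imports Defs
begin

section \<open>Terminating loops and perfect matchings\<close>

text \<open>Divergence of an algorithm would give \<open>None\<close>, so termination has to be
  proved along with the invariant; both algorithms are run through this rule.\<close>

lemma while_option_measureE:
  fixes m :: "'s \<Rightarrow> nat"
  assumes "\<And>s. P s \<Longrightarrow> b s \<Longrightarrow> P (c s)" and "\<And>s. P s \<Longrightarrow> b s \<Longrightarrow> m (c s) < m s" and "P s"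
  obtains t where "while_option b c s = Some t" "P t" "\<not> b t"
proof -
  obtain t where t: "while_option b c s = Some t"
    using measure_while_option_Some[of P b c m s] assms by blast
  moreover have "P t" using while_option_rule[of P b c, OF _ t] assms by blast
  moreover have "\<not> b t" by (rule while_option_stop[OF t])
  ultimately show thesis by (rule that)
qed

lemma perfect_matching_firm_of:
  "perfect_matching M \<Longrightarrow> firm_of M w = f \<longleftrightarrow> (w, f) \<in> M"
  unfolding perfect_matching_def firm_of_def by (metis theI')

lemma perfect_matching_worker_of:
  "perfect_matching M \<Longrightarrow> worker_of M f = w \<longleftrightarrow> (w, f) \<in> M"
  unfolding perfect_matching_def worker_of_def by (metis theI')

lemma perfect_matching_converse: "perfect_matching (M\<inverse>) \<longleftrightarrow> perfect_matching M"
  unfolding perfect_matching_def by auto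

text \<open>Pigeonhole: a choice function \<open>h\<close> inside \<open>T\<close> is injective,
  hence bijective by equal finite cardinalities. Every \<open>f\<close> is then \<open>h v\<close>
  for some \<open>v\<close>, and \<open>inj\<close> leaves \<open>(v, f)\<close> as the only pair of
  \<open>T\<close> at \<open>f\<close>, so \<open>T\<close> is the graph of
  \<open>h\<close>.\<close>

lemma perfect_matching_if_left_total:
  fixes T :: "('w::finite \<times> 'f::finite) set"
  assumes card: "CARD('w) = CARD('f)"
    and total: "\<And>w. \<exists>f. (w, f) \<in> T"
    and inj: "\<And>v w f. (v, f) \<in> T \<Longrightarrow> (w, f) \<in> T \<Longrightarrow> v = w"
  shows "perfect_matching T"
proof -
  obtain h where h: "\<And>w. (w, h w) \<in> T" using total by metis
  have inj_h: "inj h" by (rule injI) (metis h inj)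
  then have "card (range h) = CARD('f)" by (simp add: card_image card)
  then have "range h = UNIV" by (intro card_subset_eq) auto
  then have surj: "\<exists>w. h w = f" for f by (metis surjD)
  have "(w, f) \<in> T \<longleftrightarrow> f = h w" for w f
    using surj[of f] h inj by metis
  then show ?thesis
    unfolding perfect_matching_def using surj injD[OF inj_h] by metis
qed

lemma perfect_matching_if_right_total:
  fixes T :: "('w::finite \<times> 'f::finite) set"
  assumes "CARD('w) = CARD('f)"
    and "\<And>f. \<exists>w. (w, f) \<in> T"
    and "\<And>w f g. (w, f) \<in> T \<Longrightarrow> (w, g) \<in> T \<Longrightarrow> f = g"
  shows "perfect_matching T"
  using perfect_matching_if_left_total[of "T\<inverse>"] assms
  by (simp add: perfect_matching_converse)

lemma wproposals_iff:
  "(w, f) \<in> wproposals I C \<longleftrightarrow>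
     (w, f) \<notin> C \<and> (\<forall>g. (w, g) \<notin> C \<and> g \<noteq> f \<longrightarrow> (f, g) \<in> wpref I w)"
  by (simp add: wproposals_def)

lemma facceptances_iff:
  "(w, f) \<in> facceptances I H P \<longleftrightarrow>
     (w, f) \<in> P \<and> (\<forall>v. (v, f) \<in> H \<and> v \<noteq> w \<longrightarrow> (w, v) \<in> fpref I f)"
  by (simp add: facceptances_def)

lemma fproposals_iff:
  "(w, f) \<in> fproposals I C \<longleftrightarrow>
     (w, f) \<notin> C \<and> \<not> (\<exists>v. v \<noteq> w \<and> (v, f) \<notin> C \<and> (v, w) \<in> fpref I f)"
  by (simp add: fproposals_def)

lemma wacceptances_iff:
  "(w, f) \<in> wacceptances I P \<longleftrightarrow>
     (w, f) \<in> P \<and> (\<forall>g. (w, g) \<in> P \<and> g \<noteq> f \<longrightarrow> (f, g) \<in> wpref I w)"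
  by (simp add: wacceptances_def)

section \<open>The compound instance and stability in both instances\<close>

locale compound_instance =
  fixes A B :: "('w::finite, 'f::finite) prefs"
  assumes instA: "sm_instance A" and instB: "sm_instance B"
    and same_wpref: "wpref A w = wpref B w"
    and card_eq: "CARD('w) = CARD('f)"
begin

abbreviation X :: "('w, 'f) prefs" where "X \<equiv> compound A B"
abbreviation S :: "('w \<times> 'f) set set" where "S \<equiv> stable_matchings A \<inter> stable_matchings B"

lemma wpref_trans: "(f, g) \<in> wpref X w \<Longrightarrow> (g, h) \<in> wpref X w \<Longrightarrow> (f, h) \<in> wpref X w"
  and wpref_irrefl: "(f, f) \<notin> wpref X w"
  and wpref_total: "f \<noteq> g \<Longrightarrow> (f, g) \<in> wpref X w \<or> (g, f) \<in> wpref X w"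
  using instA unfolding sm_instance_def compound_def strict_linear_order_on_def
  by (auto simp: irrefl_def total_on_def dest: transD)

lemma trans_fpref: "trans (fpref X f)" and irrefl_fpref: "irrefl (fpref X f)"
  using instA instB unfolding sm_instance_def compound_def strict_linear_order_on_def
  by (auto simp: irrefl_def intro: trans_Int)

lemma fpref_irrefl: "(w, w) \<notin> fpref X f"
  using irrefl_fpref by (simp add: irrefl_def)

lemma fpref_asym: "(v, w) \<in> fpref X f \<Longrightarrow> (w, v) \<notin> fpref X f"
  using transD[OF trans_fpref] fpref_irrefl by blast

text \<open>In a linear order, not preferring \<open>w\<close> to a different partner means
  preferring the partner to \<open>w\<close>. In this positive form the conditions for
  \<open>A\<close> and \<open>B\<close> combine into membership in the intersected firm
  orders.\<close>

lemma common_stable_iff: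
  "M \<in> S \<longleftrightarrow> perfect_matching M \<and>
     (\<forall>w f. (f, firm_of M w) \<in> wpref X w \<longrightarrow> (worker_of M f, w) \<in> fpref X f)"
proof (cases "perfect_matching M")
  case True
  have total: "(v, w) \<in> fpref I f \<longleftrightarrow> (w, v) \<notin> fpref I f"
    if "sm_instance I" "v \<noteq> w" for I :: "('w, 'f) prefs" and v w f
  proof -
    have "strict_linear_order_on UNIV (fpref I f)"
      using that(1) by (simp add: sm_instance_def)
    then show ?thesis
      using that(2) unfolding strict_linear_order_on_def trans_def irrefl_def total_on_def by blast
  qed
  \<comment> \<open>A firm strictly above the partner of \<open>w\<close> is not that partner. This
    supplies the distinctness that \<open>total\<close> asks for and the first conjunct in
    \<open>stable_def\<close>.\<close>
  have notin: "(w, f) \<notin> M" "worker_of M f \<noteq> w"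
    if "(f, firm_of M w) \<in> wpref X w" for w f
    using that wpref_irrefl perfect_matching_firm_of[OF True] perfect_matching_worker_of[OF True]
    by metis+
  have stable: "stable I M \<longleftrightarrow>
     (\<forall>w f. (f, firm_of M w) \<in> wpref X w \<longrightarrow> (worker_of M f, w) \<in> fpref I f)"
    if "sm_instance I" "\<And>w. wpref I w = wpref X w" for I
    unfolding stable_def that(2) using notin total[OF that(1)] by blast
  have "wpref A w = wpref X w" "wpref B w = wpref X w" for w
    using same_wpref by (auto simp: compound_def)
  then have "M \<in> S \<longleftrightarrow>
     (\<forall>w f. (f, firm_of M w) \<in> wpref X w \<longrightarrow> (worker_of M f, w) \<in> fpref A f) \<and>
     (\<forall>w f. (f, firm_of M w) \<in> wpref X w \<longrightarrow> (worker_of M f, w) \<in> fpref B f)"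
    using True stable[OF instA] stable[OF instB] by (simp add: stable_matchings_def)
  also have "\<dots> \<longleftrightarrow>
     (\<forall>w f. (f, firm_of M w) \<in> wpref X w \<longrightarrow> (worker_of M f, w) \<in> fpref X f)"
    by (auto simp: compound_def)
  finally show ?thesis using True by simp
qed (simp add: stable_matchings_def)

lemma firm_of_mem: "M \<in> S \<Longrightarrow> (w, firm_of M w) \<in> M"
  and worker_of_mem: "M \<in> S \<Longrightarrow> (worker_of M f, f) \<in> M"
  using perfect_matching_firm_of perfect_matching_worker_of
  by (fastforce simp: stable_matchings_def)+

lemma common_stable_mem:
  "M \<in> S \<Longrightarrow> (w, f) \<in> M \<longleftrightarrow> firm_of M w = f"
  "M \<in> S \<Longrightarrow> (w, f) \<in> M \<longleftrightarrow> worker_of M f = w"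
  by (simp_all add: stable_matchings_def perfect_matching_firm_of perfect_matching_worker_of)

lemma common_stable_noblock:
  "M \<in> S \<Longrightarrow> (f, firm_of M w) \<in> wpref X w \<Longrightarrow> (worker_of M f, w) \<in> fpref X f"
  using common_stable_iff by blast

subsection \<open>Workers proposing\<close>

text \<open>The first conjunct keeps all partners from \<open>S\<close> available; with the third it
  gives optimality. The second and the last make an acceptance beat every worker who crossed the
  firm off, which gives stability.\<close>

definition winv :: "('w, 'f) wstate \<Rightarrow> bool" where
  "winv s \<longleftrightarrow>
     (\<forall>M\<in>S. wcrossed s \<inter> M = {}) \<and>
     wcrossed s \<subseteq> wproposed s \<and>
     (\<forall>w f g. (w, f) \<in> wproposed s \<longrightarrow> (g, f) \<in> wpref X w \<longrightarrow> (w, g) \<in> wcrossed s) \<and>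
     waccepted s \<subseteq> wproposed s - wcrossed s \<and>
     (\<forall>v w f. (w, f) \<in> waccepted s \<longrightarrow> (v, f) \<in> wproposed s \<longrightarrow> v \<noteq> w \<longrightarrow> (w, v) \<in> fpref X f)"

lemma wproposals_better_crossed:
  assumes "(w, f) \<in> wproposals X C" "(g, f) \<in> wpref X w"
  shows "(w, g) \<in> C"
proof (rule ccontr)
  assume "(w, g) \<notin> C"
  moreover have "g \<noteq> f" using assms(2) wpref_irrefl by blast
  ultimately have "(f, g) \<in> wpref X w" using assms(1) unfolding wproposals_iff by blast
  then show False using assms(2) wpref_trans wpref_irrefl by blast
qed

lemma wproposals_ex:
  assumes "(w, f) \<notin> C"
  shows "\<exists>g. (w, g) \<in> wproposals X C"
proof -
  have "trans (wpref X w)" "irrefl (wpref X w)"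
    using wpref_trans wpref_irrefl by (auto simp: trans_def irrefl_def)
  \<comment> \<open>Pairs are (better, worse), so a minimal element of this relation is a best
    firm.\<close>
  then have "wf (wpref X w)"
    by (intro finite_acyclic_wf) (auto simp: acyclic_irrefl)
  then obtain g where "(w, g) \<notin> C" "\<And>h. (h, g) \<in> wpref X w \<Longrightarrow> (w, h) \<in> C"
    using assms wfE_min[of "wpref X w" f "{g. (w, g) \<notin> C}"] by auto
  then show ?thesis
    unfolding wproposals_iff using wpref_total by blast
qed

text \<open>Suppose \<open>f\<close> rejects its partner \<open>w\<close> in some \<open>M\<close>
  of \<open>S\<close> because of a proposer \<open>v\<close>. All firms that \<open>v\<close> ranks
  above \<open>f\<close> are crossed off by \<open>v\<close>, so \<open>v\<close> prefers
  \<open>f\<close> to its own partner in \<open>M\<close>. Stability then puts \<open>w\<close>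
  above \<open>v\<close> in the order of \<open>f\<close>, so \<open>v\<close> was no
  obstacle.\<close>

lemma winv_wround:
  assumes "winv s"
  shows "winv (wround X s)"
proof -
  define P where "P = wproposals X (wcrossed s)"
  define H where "H = wproposed s \<union> P"
  define T where "T = facceptances X H P"
  have round: "wround X s = \<lparr> wcrossed = wcrossed s \<union> (P - T), wproposed = H, waccepted = T \<rparr>"
    by (simp add: wround_def P_def H_def T_def Let_def)
  \<comment> \<open>The conclusion names the old crossing set, which is already known to avoid the
    members of \<open>S\<close>.\<close>
  have down: "(w, g) \<in> wcrossed s" if "(w, f) \<in> H" "(g, f) \<in> wpref X w" for w f g
    using that assms wproposals_better_crossed unfolding H_def P_def winv_def by blast
  have safe: "(w, f) \<notin> M" if M: "M \<in> S" and rej: "(w, f) \<in> P - T" for M w f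
  proof
    assume wf: "(w, f) \<in> M"
    obtain v where v: "(v, f) \<in> H" "v \<noteq> w" "(w, v) \<notin> fpref X f"
      using rej by (auto simp: T_def facceptances_iff)
    have "worker_of M f = w" using common_stable_mem(2)[OF M] wf by blast
    then have "firm_of M v \<noteq> f" using v(2) common_stable_mem[OF M] by metis
    moreover have "(firm_of M v, f) \<notin> wpref X v"
      using down[OF v(1)] firm_of_mem[OF M] M assms unfolding winv_def by blast
    ultimately have "(f, firm_of M v) \<in> wpref X v" using wpref_total by blast
    then have "(w, v) \<in> fpref X f"
      using common_stable_noblock[OF M] \<open>worker_of M f = w\<close> by blast
    with v(3) show False by blast
  qed
  have TP: "T \<subseteq> P" by (auto simp: T_def facceptances_iff)
  have PC: "P \<inter> wcrossed s = {}" by (auto simp: P_def wproposals_iff)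
  have safe': "(P - T) \<inter> M = {}" if "M \<in> S" for M
    using safe[OF that] by auto
  show ?thesis
    unfolding winv_def round wstate.simps
  proof (intro conjI allI impI)
    show "\<forall>M\<in>S. (wcrossed s \<union> (P - T)) \<inter> M = {}"
      using safe' assms unfolding winv_def by (simp add: Int_Un_distrib2)
    show "wcrossed s \<union> (P - T) \<subseteq> H"
      using assms unfolding winv_def H_def by auto
    show "T \<subseteq> H - (wcrossed s \<union> (P - T))"
      using TP PC unfolding H_def by auto
    show "(w, g) \<in> wcrossed s \<union> (P - T)" if "(w, f) \<in> H" "(g, f) \<in> wpref X w" for w f g
      using down[OF that] by simp
    show "(w, v) \<in> fpref X f" if "(w, f) \<in> T" "(v, f) \<in> H" "v \<noteq> w" for v w f
      using that by (simp add: T_def facceptances_iff)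
  qed
qed

text \<open>The factor 2 leaves room for a last round without rejections, which only fills
  \<^const>\<open>waccepted\<close>.\<close>

definition wmeasure :: "('w, 'f) wstate \<Rightarrow> nat" where
  "wmeasure s = 2 * card (- wcrossed s) + (if all_workers_hold s then 0 else 1)"

text \<open>A round without rejections satisfies every worker, as each still has a firm to propose
  to. Any other round crosses off a fresh pair, proposals being uncrossed.\<close>

lemma wmeasure_wround:
  assumes "\<not> all_workers_hold s" "\<not> worker_exhausted s"
  shows "wmeasure (wround X s) < wmeasure s"
proof -
  let ?P = "wproposals X (wcrossed s)"
  let ?t = "wround X s"
  have t: "wcrossed ?t = wcrossed s \<union> (?P - waccepted ?t)"
    by (simp add: wround_def Let_def)
  have PC: "?P \<inter> wcrossed s = {}" by (auto simp: wproposals_iff)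
  show ?thesis
  proof (cases "?P \<subseteq> waccepted ?t")
    case True
    have "\<exists>f. (w, f) \<in> ?P" for w
      using assms(2) wproposals_ex unfolding worker_exhausted_def by blast
    then have "all_workers_hold ?t" unfolding all_workers_hold_def using True by blast
    moreover have "wcrossed ?t = wcrossed s" using t True by blast
    ultimately show ?thesis using assms(1) by (simp add: wmeasure_def)
  next
    case False
    then have "- wcrossed ?t \<subset> - wcrossed s" using t PC by blast
    then have "card (- wcrossed ?t) < card (- wcrossed s)" by (simp add: psubset_card_mono)
    then show ?thesis using assms(1) by (simp add: wmeasure_def)
  qed
qed

lemma winv_worker_optimal:
  assumes inv: "winv s" and hold: "all_workers_hold s"
  shows "worker_optimal X S (waccepted s)"
proof -
  let ?T = "waccepted s"
  have acc: "?T \<subseteq> wproposed s - wcrossed s"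
    and best: "\<And>v w f. (w, f) \<in> ?T \<Longrightarrow> (v, f) \<in> wproposed s \<Longrightarrow> v \<noteq> w \<Longrightarrow> (w, v) \<in> fpref X f"
    and down: "\<And>w f g. (w, f) \<in> ?T \<Longrightarrow> (g, f) \<in> wpref X w \<Longrightarrow> (w, g) \<in> wcrossed s"
    and CH: "wcrossed s \<subseteq> wproposed s"
    and safe: "\<And>M. M \<in> S \<Longrightarrow> wcrossed s \<inter> M = {}"
    using inv unfolding winv_def by blast+
  have pm: "perfect_matching ?T"
  proof (rule perfect_matching_if_left_total[OF card_eq])
    show "\<exists>f. (w, f) \<in> ?T" for w using hold unfolding all_workers_hold_def by blast
    \<comment> \<open>Two different workers held by one firm would each rank above the
      other.\<close>
    show "v = w" if "(v, f) \<in> ?T" "(w, f) \<in> ?T" for v w f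
      using that best acc fpref_asym by blast
  qed
  have memW: "(w, firm_of ?T w) \<in> ?T" and memF: "(worker_of ?T f, f) \<in> ?T" for w f
    using pm perfect_matching_firm_of perfect_matching_worker_of by fastforce+
  have "?T \<in> S"
    unfolding common_stable_iff
  proof (intro conjI allI impI)
    \<comment> \<open>Such an \<open>f\<close> was crossed off by \<open>w\<close>, hence once
      received its proposal, and what \<open>f\<close> holds beats all proposers.\<close>
    fix w f assume "(f, firm_of ?T w) \<in> wpref X w"
    then have C: "(w, f) \<in> wcrossed s" using down memW by blast
    then have "w \<noteq> worker_of ?T f" using acc memF by blast
    then show "(worker_of ?T f, w) \<in> fpref X f" using C CH best memF by blast
  qed (rule pm)
  moreover have "firm_of ?T w = firm_of N w \<or> (firm_of ?T w, firm_of N w) \<in> wpref X w"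
    if "N \<in> S" for N w
    using safe[OF that] firm_of_mem[OF that] down memW wpref_total by blast
  ultimately show ?thesis unfolding worker_optimal_def by blast
qed

theorem WorkerOptimal_X_correct:
  assumes "S \<noteq> {}"
  shows "\<exists>M. worker_optimal X S M \<and> WorkerOptimal_X X = Some (Output M)"
proof -
  let ?b = "\<lambda>s. \<not> (all_workers_hold s \<or> worker_exhausted s)"
  let ?init = "\<lparr> wcrossed = {}, wproposed = {}, waccepted = {} \<rparr> :: ('w, 'f) wstate"
  have "winv ?init" by (simp add: winv_def)
  then obtain t where t: "while_option ?b (wround X) ?init = Some t" "winv t" "\<not> ?b t"
    using winv_wround wmeasure_wround
    by - (rule while_option_measureE[where P = winv and b = ?b and c = "wround X"
        and m = wmeasure and s = ?init], blast+)
  obtain M where M: "M \<in> S" using assms by blast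
  \<comment> \<open>The partner in \<open>M\<close> is never crossed off, which excludes
    \<open>Boxtimes\<close>.\<close>
  have "\<not> worker_exhausted t"
    using t(2) M firm_of_mem[OF M] unfolding winv_def worker_exhausted_def by (meson disjoint_iff)
  then have "all_workers_hold t" using t(3) by blast
  then show ?thesis
    using t(1) winv_worker_optimal[OF t(2)] by (auto simp: WorkerOptimal_X_def)
qed

subsection \<open>Firms proposing\<close>

text \<open>The second conjunct records that workers only improve; the fourth keeps it alive, since
  held firms propose again. The last is conditional because only a round without rejections accepts
  all maximal uncrossed workers.\<close>

definition finv :: "('w, 'f) fstate \<Rightarrow> bool" where
  "finv s \<longleftrightarrow>
     (\<forall>M\<in>S. fcrossed s \<inter> M = {}) \<and>
     (\<forall>w f. (w, f) \<in> fcrossed s \<longrightarrow> (\<exists>g. (w, g) \<in> faccepted s \<and> (g, f) \<in> wpref X w)) \<and>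
     (\<forall>w f g. (w, f) \<in> faccepted s \<longrightarrow> (w, g) \<in> faccepted s \<longrightarrow> f = g) \<and>
     faccepted s \<subseteq> fproposals X (fcrossed s) \<and>
     (all_firms_hold s \<longrightarrow> faccepted s = fproposals X (fcrossed s))"

lemma wacceptances_ex:
  assumes "(w, f) \<in> P"
  shows "\<exists>g. (w, g) \<in> wacceptances X P \<and> (g = f \<or> (g, f) \<in> wpref X w)"
proof -
  \<comment> \<open>With this crossing set, \<open>wproposals\<close> picks the best firm of
    \<open>w\<close> within \<open>P\<close>, so the existence result for proposals applies.\<close>
  let ?C = "- P"
  obtain g where g: "(w, g) \<in> wproposals X ?C" using wproposals_ex assms by blast
  then have "(w, g) \<in> wacceptances X P" unfolding wproposals_iff wacceptances_iff by blast
  moreover have "g = f \<or> (g, f) \<in> wpref X w" using g assms unfolding wproposals_iff by blast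
  ultimately show ?thesis by blast
qed

lemma fproposals_ex:
  assumes "(w, f) \<notin> C"
  shows "\<exists>v. (v, f) \<in> fproposals X C \<and> (v = w \<or> (v, w) \<in> fpref X f)"
proof -
  \<comment> \<open>The order is partial, so the search is confined to workers weakly above
    \<open>w\<close>; by transitivity a maximal one there is maximal among all uncrossed
    workers.\<close>
  let ?Q = "{v. (v, f) \<notin> C \<and> (v = w \<or> (v, w) \<in> fpref X f)}"
  have "wf (fpref X f)"
    using trans_fpref irrefl_fpref by (intro finite_acyclic_wf) (auto simp: acyclic_irrefl)
  then obtain v where "v \<in> ?Q" "\<And>u. (u, v) \<in> fpref X f \<Longrightarrow> u \<notin> ?Q"
    using assms wfE_min[of "fpref X f" w ?Q] by blast
  then show ?thesis
    unfolding fproposals_iff using transD[OF trans_fpref] by blast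
qed

text \<open>If \<open>w\<close> rejects its partner \<open>f\<close> in some \<open>M\<close> of
  \<open>S\<close>, it does so for a better proposer \<open>g\<close>. Stability puts the partner of
  \<open>g\<close> in \<open>M\<close> above \<open>w\<close>, and that partner is uncrossed, so
  \<open>g\<close> could not have proposed to \<open>w\<close>.\<close>

lemma finv_fround:
  assumes "finv s"
  shows "finv (fround X s)"
proof -
  define P where "P = fproposals X (fcrossed s)"
  define T where "T = wacceptances X P"
  let ?C = "fcrossed s \<union> (P - T)"
  have round: "fround X s = \<lparr> fcrossed = ?C, faccepted = T, frejected = P - T \<rparr>"
    by (simp add: fround_def P_def T_def Let_def)
  have TP: "T \<subseteq> P" by (auto simp: T_def wacceptances_iff)
  have better: "\<exists>g. (w, g) \<in> T \<and> (g, f) \<in> wpref X w" if "(w, f) \<in> P - T" for w f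
    using that wacceptances_ex[of w f P] unfolding T_def by blast
  have safe: "(w, f) \<notin> M" if M: "M \<in> S" and rej: "(w, f) \<in> P - T" for M w f
  proof
    assume wf: "(w, f) \<in> M"
    obtain g where g: "(w, g) \<in> P" "(g, f) \<in> wpref X w" using better[OF rej] TP by blast
    have "firm_of M w = f" using common_stable_mem(1)[OF M] wf by blast
    then have "(worker_of M g, w) \<in> fpref X g" using common_stable_noblock[OF M] g(2) by blast
    moreover have "(worker_of M g, g) \<notin> fcrossed s"
      using worker_of_mem[OF M] M assms unfolding finv_def by blast
    ultimately show False using g(1) fpref_irrefl unfolding P_def fproposals_iff by metis
  qed
  have safe': "(P - T) \<inter> M = {}" if "M \<in> S" for M
    using safe[OF that] by auto
  show ?thesis
    unfolding finv_def round fstate.simps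
  proof (intro conjI allI impI)
    show "\<forall>M\<in>S. ?C \<inter> M = {}"
      using safe' assms unfolding finv_def by (simp add: Int_Un_distrib2)
    show "\<exists>g. (w, g) \<in> T \<and> (g, f) \<in> wpref X w" if "(w, f) \<in> ?C" for w f
    proof (cases "(w, f) \<in> P - T")
      case False
      then have "(w, f) \<in> fcrossed s" using that by blast
      \<comment> \<open>The firm held by \<open>w\<close> proposes again, so the new acceptance of
        \<open>w\<close> is at least as good.\<close>
      moreover have "faccepted s \<subseteq> P" using assms unfolding finv_def P_def by blast
      ultimately obtain g where g: "(w, g) \<in> P" "(g, f) \<in> wpref X w"
        using assms unfolding finv_def by (meson subsetD)
      then show ?thesis using wacceptances_ex[OF g(1)] wpref_trans unfolding T_def by metis
    qed (rule better)
    show "f = g" if "(w, f) \<in> T" "(w, g) \<in> T" for w f g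
      using that wpref_trans wpref_irrefl unfolding T_def wacceptances_iff by metis
    \<comment> \<open>Removing further workers preserves maximality, and no accepted pair is newly
      crossed off.\<close>
    show "T \<subseteq> fproposals X ?C"
      using TP by (auto simp: P_def fproposals_iff dest!: subsetD)
  next
    assume "all_firms_hold
      \<lparr> fcrossed = ?C, faccepted = T, frejected = P - T \<rparr>"
    \<comment> \<open>Holding an acceptance includes having no rejection in the round.\<close>
    then have "P - T = {}"
      unfolding all_firms_hold_def holds_acceptance_def by auto
    then have "T = P" "?C = fcrossed s" using TP by auto
    then show "T = fproposals X ?C" by (simp add: P_def)
  qed
qed

definition fmeasure :: "('w, 'f) fstate \<Rightarrow> nat" where
  "fmeasure s = 2 * card (- fcrossed s) + (if all_firms_hold s then 0 else 1)"

lemma fmeasure_fround: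
  assumes "\<not> all_firms_hold s" "\<not> firm_exhausted s"
  shows "fmeasure (fround X s) < fmeasure s"
proof -
  let ?P = "fproposals X (fcrossed s)"
  let ?t = "fround X s"
  have t: "fcrossed ?t = fcrossed s \<union> frejected ?t" "frejected ?t = ?P - faccepted ?t"
    by (simp_all add: fround_def Let_def)
  have PC: "?P \<inter> fcrossed s = {}" by (auto simp: fproposals_iff)
  show ?thesis
  proof (cases "?P \<subseteq> faccepted ?t")
    case True
    have "\<exists>w. (w, f) \<in> ?P" for f
      using assms(2) fproposals_ex unfolding firm_exhausted_def by blast
    then have "all_firms_hold ?t"
      unfolding all_firms_hold_def holds_acceptance_def t(2) using True by blast
    moreover have "fcrossed ?t = fcrossed s" using t True by blast
    ultimately show ?thesis using assms(1) by (simp add: fmeasure_def)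
  next
    case False
    then have "- fcrossed ?t \<subset> - fcrossed s" using t PC by blast
    then have "card (- fcrossed ?t) < card (- fcrossed s)" by (simp add: psubset_card_mono)
    then show ?thesis using assms(1) by (simp add: fmeasure_def)
  qed
qed

lemma finv_firm_optimal:
  assumes inv: "finv s" and hold: "all_firms_hold s"
  shows "firm_optimal X S (faccepted s)"
proof -
  let ?T = "faccepted s"
  have safe: "\<And>M. M \<in> S \<Longrightarrow> fcrossed s \<inter> M = {}"
    and better: "\<And>w f. (w, f) \<in> fcrossed s \<Longrightarrow> \<exists>g. (w, g) \<in> ?T \<and> (g, f) \<in> wpref X w"
    and uniq: "\<And>w f g. (w, f) \<in> ?T \<Longrightarrow> (w, g) \<in> ?T \<Longrightarrow> f = g"
    and TP: "?T = fproposals X (fcrossed s)"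
    using inv hold unfolding finv_def by blast+
  \<comment> \<open>A firm may propose to several workers; that it ends with a single one follows by
    counting, as each worker holds at most one firm.\<close>
  have pm: "perfect_matching ?T"
    using hold uniq unfolding all_firms_hold_def holds_acceptance_def
    by (intro perfect_matching_if_right_total[OF card_eq]) blast+
  have memW: "(w, firm_of ?T w) \<in> ?T" for w
    using pm perfect_matching_firm_of by fastforce
  \<comment> \<open>Some maximal uncrossed worker lies weakly above \<open>w\<close>, and
    \<open>?T\<close> contains all of these but only one per firm.\<close>
  have top: "worker_of ?T f = w \<or> (worker_of ?T f, w) \<in> fpref X f"
    if uncrossed: "(w, f) \<notin> fcrossed s" for w f
  proof -
    obtain v where "(v, f) \<in> ?T" "v = w \<or> (v, w) \<in> fpref X f"
      unfolding TP using fproposals_ex[OF uncrossed] by blast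
    then show ?thesis using perfect_matching_worker_of[OF pm, of f v] by blast
  qed
  have "?T \<in> S"
    unfolding common_stable_iff
  proof (intro conjI allI impI)
    fix w f assume wf: "(f, firm_of ?T w) \<in> wpref X w"
    \<comment> \<open>Otherwise \<open>w\<close> would hold a firm better than \<open>f\<close>, yet
      its only firm is worse.\<close>
    have "(w, f) \<notin> fcrossed s"
      using better uniq[OF memW] wf wpref_trans wpref_irrefl by metis
    moreover have "worker_of ?T f \<noteq> w"
      using wf wpref_irrefl perfect_matching_firm_of[OF pm] perfect_matching_worker_of[OF pm]
      by metis
    ultimately show "(worker_of ?T f, w) \<in> fpref X f" using top by blast
  qed (rule pm)
  moreover have "worker_of ?T f = worker_of N f \<or> (worker_of ?T f, worker_of N f) \<in> fpref X f"
    if "N \<in> S" for N f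
    using safe[OF that] worker_of_mem[OF that] top by blast
  ultimately show ?thesis unfolding firm_optimal_def by blast
qed

theorem FirmOptimal_X_correct:
  assumes "S \<noteq> {}"
  shows "\<exists>M. firm_optimal X S M \<and> FirmOptimal_X X = Some (Output M)"
proof -
  let ?b = "\<lambda>s. \<not> (all_firms_hold s \<or> firm_exhausted s)"
  let ?init = "\<lparr> fcrossed = {}, faccepted = {}, frejected = {} \<rparr> :: ('w, 'f) fstate"
  have "finv ?init" by (simp add: finv_def all_firms_hold_def holds_acceptance_def)
  then obtain t where t: "while_option ?b (fround X) ?init = Some t" "finv t" "\<not> ?b t"
    using finv_fround fmeasure_fround
    by - (rule while_option_measureE[where P = finv and b = ?b and c = "fround X"
        and m = fmeasure and s = ?init], blast+)
  obtain M where M: "M \<in> S" using assms by blast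
  have "\<not> firm_exhausted t"
    using t(2) M worker_of_mem[OF M] unfolding finv_def firm_exhausted_def by (meson disjoint_iff)
  then have "all_firms_hold t" using t(3) by blast
  then show ?thesis
    using t(1) finv_firm_optimal[OF t(2)] by (auto simp: FirmOptimal_X_def)
qed

end

theorem theorem6:
  fixes A B X :: "('w::finite, 'f::finite) prefs" and n :: nat
  assumes "CARD('w) = n" and "CARD('f) = n"
    and "sm_instance A" and "sm_instance B"
    and "\<forall>w. wpref A w = wpref B w"
    and "X = compound A B"
    and "stable_matchings A \<inter> stable_matchings B \<noteq> {}"
  shows "(\<exists>M. worker_optimal X (stable_matchings A \<inter> stable_matchings B) M
              \<and> WorkerOptimal_X X = Some (Output M))
       \<and> (\<exists>M. firm_optimal X (stable_matchings A \<inter> stable_matchings B) M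
              \<and> FirmOptimal_X X = Some (Output M))"
proof -
  interpret compound_instance A B
    by unfold_locales (use assms in auto)
  show ?thesis
    unfolding assms(6) using WorkerOptimal_X_correct FirmOptimal_X_correct assms(7) by blast
qed

end
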